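(* Assume $\psi_2\le\psi_1$ on $\mathbb{R}^d$. A continuous function $v:\mathbb{R}^d\to\mathbb{R}$ is a viscosity solution of $$\lambda v(x)-\bar H^+(x,Dv(x),D^2v(x))=0$$ if and only if it is a viscosity solution (in the sense defined in the context) of the variational inequalities $$ \left.\begin{array}{ll} \psi_2(x)\le v(x)\le\psi_1(x), & \forall x\\ \lambda v(x)-H^+(x,Dv(x),D^2v(x))=0, & \text{if }\psi_2(x)<v(x)<\psi_1(x)\\ \lambda v(x)-H^+(x,Dv(x),D^2v(x))\ge 0, & \text{if }v(x)=\psi_2(x)\\ \lambda v(x)-H^+(x,Dv(x),D^2v(x))\le 0, & \text{if }v(x)=\psi_1(x). \end{array}\right\}\quad(\mathrm{VI}^+) $$ Similarly, a continuous function $v:\mathbb{R}^d\to\mathbb{R}$ is a viscosity solution of $$\lambda v(x)-\bar H^-(x,Dv(x),D^2v(x))=0$$ if and only if it is a viscosity solution (in the sense defined in the context) of the variational inequalities $(\mathrm{VI}^-)$ obtained from $(\mathrm{VI}^+)$ by replacing $H^+$ with $H^-$.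
   Context: **Data.** $\lambda>0$ is a constant; $U_1,U_2$ are compact metric spaces; $b:\mathbb{R}^d\times U_1\times U_2\to\mathbb{R}^d$, $a:\mathbb{R}^d\times U_1\times U_2\to\mathbb{R}^{d\times d}$ (with symmetric non-negative definite values), $r:\mathbb{R}^d\times U_1\times U_2\to\mathbb{R}$, and $\psi_1,\psi_2:\mathbb{R}^d\to\mathbb{R}$. The functions $$H^+(x,p,X)=\inf_{u_1\in U_1}\sup_{u_2\in U_2}\left[\tfrac12\mathrm{tr}(a(x,u_1,u_2)X)+b(x,u_1,u_2)\cdot p+r(x,u_1,u_2)\right],$$ $$H^-(x,p,X)=\sup_{u_2\in U_2}\inf_{u_1\in U_1}\left[\tfrac12\mathrm{tr}(a(x,u_1,u_2)X)+b(x,u_1,u_2)\cdot p+r(x,u_1,u_2)\right]$$ are taken to be real-valued on $\mathbb{R}^d\times\mathbb{R}^d\times\mathbb{R}^{d\times d}$. **Extended data.** Let $\omega_1,\omega_2$ be two symbols, $\bar U_i=U_i\cup\{\omega_i\}$, and let $\sigma$ be the non-negative square root of $a$. Extend $b,\sigma,r$ to functions $\bar b,\bar\sigma,\bar r$ on $\mathbb{R}^d\times\bar U_1\times\bar U_2$ by $\bar b(x,\omega_1,\cdot)\equiv0$, $\bar b(x,\cdot,\omega_2)\equiv0$, $\bar\sigma(x,\omega_1,\cdot)\equiv0$, $\bar\sigma(x,\cdot,\omega_2)\equiv0$, $\bar r(x,\omega_1,u_2)=\lambda\psi_1(x)$ for all $u_2\in U_2$, and $\bar r(x,\cdot,\omega_2)\equiv\lambda\psi_2(x)$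 (including at $(\omega_1,\omega_2)$). With $\hat a=\bar\sigma\bar\sigma^*$ define $$\bar H^+(x,p,X)=\inf_{\bar u_1\in\bar U_1}\sup_{\bar u_2\in\bar U_2}\left[\tfrac12\mathrm{tr}(\hat a(x,\bar u_1,\bar u_2)X)+\bar b(x,\bar u_1,\bar u_2)\cdot p+\bar r(x,\bar u_1,\bar u_2)\right],$$ $$\bar H^-(x,p,X)=\sup_{\bar u_2\in\bar U_2}\inf_{\bar u_1\in\bar U_1}\left[\tfrac12\mathrm{tr}(\hat a(x,\bar u_1,\bar u_2)X)+\bar b(x,\bar u_1,\bar u_2)\cdot p+\bar r(x,\bar u_1,\bar u_2)\right].$$ **Viscosity solutions.** For an equation $F(x,v,Dv,D^2v)=0$ on $\mathbb{R}^d$, an upper semicontinuous $v$ is a viscosity subsolution if for every $\varphi\in C^2(\mathbb{R}^d)$ and every local maximum point $x$ of $v-\varphi$ one has $F(x,v(x),D\varphi(x),D^2\varphi(x))\le 0$; a lower semicontinuous $v$ is a viscosity supersolution if for every $\varphi\in C^2(\mathbb{R}^d)$ and every local minimum point $x$ of $v-\varphi$ one has $F(x,v(x),D\varphi(x),D^2\varphi(x))\ge0$; a viscosity solution is both. By definition, a viscosity solution of $(\mathrm{VI}^+)$ is a viscosity solution of $$\max\{\min\{\lambda v(x)-H^+(x,Dv(x),D^2v(x));\ \lambda(v(x)-\psi_2(x))\};\ \lambda(v(x)-\psi_1(x))\}=0,$$ and a viscosity solution of $(\mathrm{VI}^-)$ is a viscosity solution of $$\min\{\max\{\lambda v(x)-H^-(x,Dv(x),D^2v(x));\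 \lambda(v(x)-\psi_1(x))\};\ \lambda(v(x)-\psi_2(x))\}=0.$$ *)

theory Defs
  imports "HOL-Analysis.Analysis"
begin

definition nonneg_definite :: "real^'n^'n \<Rightarrow> bool" where
  "nonneg_definite A \<longleftrightarrow> transpose A = A \<and> (\<forall>y. 0 \<le> y \<bullet> (A *v y))"

(* Meaningful for symmetric non-negative definite A, where the root exists and is unique. *)
definition nonneg_sqrt :: "real^'n^'n \<Rightarrow> real^'n^'n" where
  "nonneg_sqrt A = (THE S. nonneg_definite S \<and> S ** S = A)"


section \<open>Isaacs Hamiltonians\<close>

definition isaacs_integrand ::
  "(real^'n \<Rightarrow> 'u \<Rightarrow> 'w \<Rightarrow> real^'n^'n) \<Rightarrow> (real^'n \<Rightarrow> 'u \<Rightarrow> 'w \<Rightarrow> real^'n) \<Rightarrow> (real^'n \<Rightarrow> 'u \<Rightarrow> 'w \<Rightarrow> real)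
    \<Rightarrow> real^'n \<Rightarrow> real^'n \<Rightarrow> real^'n^'n \<Rightarrow> 'u \<Rightarrow> 'w \<Rightarrow> real" where
  "isaacs_integrand a b r x p X u1 u2 =
     1/2 * trace (a x u1 u2 ** X) + b x u1 u2 \<bullet> p + r x u1 u2"

text \<open>The infima and suprema are taken in the extended reals, so that they are always the genuine
  ones; that a Hamiltonian is real-valued is then a hypothesis.\<close>

definition isaacs_upper ::
  "'u set \<Rightarrow> 'w set \<Rightarrow> (real^'n \<Rightarrow> 'u \<Rightarrow> 'w \<Rightarrow> real^'n^'n) \<Rightarrow> (real^'n \<Rightarrow> 'u \<Rightarrow> 'w \<Rightarrow> real^'n)
    \<Rightarrow> (real^'n \<Rightarrow> 'u \<Rightarrow> 'w \<Rightarrow> real) \<Rightarrow> real^'n \<Rightarrow> real^'n \<Rightarrow> real^'n^'n \<Rightarrow> ereal" where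
  "isaacs_upper U1 U2 a b r x p X =
     (INF u1\<in>U1. SUP u2\<in>U2. ereal (isaacs_integrand a b r x p X u1 u2))"

definition isaacs_lower ::
  "'u set \<Rightarrow> 'w set \<Rightarrow> (real^'n \<Rightarrow> 'u \<Rightarrow> 'w \<Rightarrow> real^'n^'n) \<Rightarrow> (real^'n \<Rightarrow> 'u \<Rightarrow> 'w \<Rightarrow> real^'n)
    \<Rightarrow> (real^'n \<Rightarrow> 'u \<Rightarrow> 'w \<Rightarrow> real) \<Rightarrow> real^'n \<Rightarrow> real^'n \<Rightarrow> real^'n^'n \<Rightarrow> ereal" where
  "isaacs_lower U1 U2 a b r x p X =
     (SUP u2\<in>U2. INF u1\<in>U1. ereal (isaacs_integrand a b r x p X u1 u2))"


section \<open>Extended data\<close>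

text \<open>The added symbols \<open>\<omega>\<^sub>1\<close> and \<open>\<omega>\<^sub>2\<close> are \<open>None\<close>; original controls are tagged by \<open>Some\<close>.\<close>

definition adjoin_symbol :: "'u set \<Rightarrow> 'u option set" where
  "adjoin_symbol U = insert None (Some ` U)"

definition extend_zero ::
  "('x \<Rightarrow> 'u \<Rightarrow> 'w \<Rightarrow> 'c::zero) \<Rightarrow> 'x \<Rightarrow> 'u option \<Rightarrow> 'w option \<Rightarrow> 'c" where
  "extend_zero f x w1 w2 = (case (w1, w2) of (Some u1, Some u2) \<Rightarrow> f x u1 u2 | _ \<Rightarrow> 0)"

definition sigma_bar ::
  "(real^'n \<Rightarrow> 'u \<Rightarrow> 'w \<Rightarrow> real^'n^'n) \<Rightarrow> real^'n \<Rightarrow> 'u option \<Rightarrow> 'w option \<Rightarrow> real^'n^'n" where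
  "sigma_bar a = extend_zero (\<lambda>x u1 u2. nonneg_sqrt (a x u1 u2))"

definition a_hat ::
  "(real^'n \<Rightarrow> 'u \<Rightarrow> 'w \<Rightarrow> real^'n^'n) \<Rightarrow> real^'n \<Rightarrow> 'u option \<Rightarrow> 'w option \<Rightarrow> real^'n^'n" where
  "a_hat a x w1 w2 = sigma_bar a x w1 w2 ** transpose (sigma_bar a x w1 w2)"

definition r_bar ::
  "real \<Rightarrow> ('x \<Rightarrow> real) \<Rightarrow> ('x \<Rightarrow> real) \<Rightarrow> ('x \<Rightarrow> 'u \<Rightarrow> 'w \<Rightarrow> real)
    \<Rightarrow> 'x \<Rightarrow> 'u option \<Rightarrow> 'w option \<Rightarrow> real" where
  "r_bar lam psi1 psi2 r x w1 w2 =
     (case w2 of None \<Rightarrow> lam * psi2 x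
      | Some u2 \<Rightarrow> (case w1 of None \<Rightarrow> lam * psi1 x | Some u1 \<Rightarrow> r x u1 u2))"

definition isaacs_upper_bar ::
  "real \<Rightarrow> (real^'n \<Rightarrow> real) \<Rightarrow> (real^'n \<Rightarrow> real) \<Rightarrow> 'u set \<Rightarrow> 'w set
    \<Rightarrow> (real^'n \<Rightarrow> 'u \<Rightarrow> 'w \<Rightarrow> real^'n^'n) \<Rightarrow> (real^'n \<Rightarrow> 'u \<Rightarrow> 'w \<Rightarrow> real^'n)
    \<Rightarrow> (real^'n \<Rightarrow> 'u \<Rightarrow> 'w \<Rightarrow> real) \<Rightarrow> real^'n \<Rightarrow> real^'n \<Rightarrow> real^'n^'n \<Rightarrow> ereal" where
  "isaacs_upper_bar lam psi1 psi2 U1 U2 a b r =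
     isaacs_upper (adjoin_symbol U1) (adjoin_symbol U2)
       (a_hat a) (extend_zero b) (r_bar lam psi1 psi2 r)"

definition isaacs_lower_bar ::
  "real \<Rightarrow> (real^'n \<Rightarrow> real) \<Rightarrow> (real^'n \<Rightarrow> real) \<Rightarrow> 'u set \<Rightarrow> 'w set
    \<Rightarrow> (real^'n \<Rightarrow> 'u \<Rightarrow> 'w \<Rightarrow> real^'n^'n) \<Rightarrow> (real^'n \<Rightarrow> 'u \<Rightarrow> 'w \<Rightarrow> real^'n)
    \<Rightarrow> (real^'n \<Rightarrow> 'u \<Rightarrow> 'w \<Rightarrow> real) \<Rightarrow> real^'n \<Rightarrow> real^'n \<Rightarrow> real^'n^'n \<Rightarrow> ereal" where
  "isaacs_lower_bar lam psi1 psi2 U1 U2 a b r =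
     isaacs_lower (adjoin_symbol U1) (adjoin_symbol U2)
       (a_hat a) (extend_zero b) (r_bar lam psi1 psi2 r)"


section \<open>Viscosity solutions\<close>

definition gradient :: "(real^'n \<Rightarrow> real) \<Rightarrow> real^'n \<Rightarrow> real^'n" where
  "gradient f x = (\<chi> i. frechet_derivative f (at x) (axis i 1))"

definition hessian :: "(real^'n \<Rightarrow> real) \<Rightarrow> real^'n \<Rightarrow> real^'n^'n" where
  "hessian f x = jacobian (gradient f) (at x)"

definition C2_function :: "(real^'n \<Rightarrow> real) \<Rightarrow> bool" where
  "C2_function f \<longleftrightarrow> f differentiable_on UNIV \<and> gradient f differentiable_on UNIV
     \<and> continuous_on UNIV (hessian f)"

definition upper_semicont :: "('x::topological_space \<Rightarrow> real) \<Rightarrow> bool" where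
  "upper_semicont v \<longleftrightarrow> (\<forall>c. open {x. v x < c})"

definition lower_semicont :: "('x::topological_space \<Rightarrow> real) \<Rightarrow> bool" where
  "lower_semicont v \<longleftrightarrow> (\<forall>c. open {x. c < v x})"

definition local_max_at :: "('x::topological_space \<Rightarrow> real) \<Rightarrow> 'x \<Rightarrow> bool" where
  "local_max_at g x \<longleftrightarrow> (\<forall>\<^sub>F y in nhds x. g y \<le> g x)"

definition local_min_at :: "('x::topological_space \<Rightarrow> real) \<Rightarrow> 'x \<Rightarrow> bool" where
  "local_min_at g x \<longleftrightarrow> (\<forall>\<^sub>F y in nhds x. g x \<le> g y)"

text \<open>The arguments of \<open>F\<close> are a point, a value, a gradient and a Hessian. \<open>F\<close> has extended real
  values only because the Hamiltonians above do.\<close>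

definition viscosity_subsolution ::
  "(real^'n \<Rightarrow> real \<Rightarrow> real^'n \<Rightarrow> real^'n^'n \<Rightarrow> ereal) \<Rightarrow> (real^'n \<Rightarrow> real) \<Rightarrow> bool" where
  "viscosity_subsolution F v \<longleftrightarrow> upper_semicont v \<and>
     (\<forall>\<phi> x. C2_function \<phi> \<and> local_max_at (\<lambda>y. v y - \<phi> y) x
        \<longrightarrow> F x (v x) (gradient \<phi> x) (hessian \<phi> x) \<le> 0)"

definition viscosity_supersolution ::
  "(real^'n \<Rightarrow> real \<Rightarrow> real^'n \<Rightarrow> real^'n^'n \<Rightarrow> ereal) \<Rightarrow> (real^'n \<Rightarrow> real) \<Rightarrow> bool" where
  "viscosity_supersolution F v \<longleftrightarrow> lower_semicont v \<and>
     (\<forall>\<phi> x. C2_function \<phi> \<and> local_min_at (\<lambda>y. v y - \<phi> y) x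
        \<longrightarrow> F x (v x) (gradient \<phi> x) (hessian \<phi> x) \<ge> 0)"

definition viscosity_solution ::
  "(real^'n \<Rightarrow> real \<Rightarrow> real^'n \<Rightarrow> real^'n^'n \<Rightarrow> ereal) \<Rightarrow> (real^'n \<Rightarrow> real) \<Rightarrow> bool" where
  "viscosity_solution F v \<longleftrightarrow> viscosity_subsolution F v \<and> viscosity_supersolution F v"

definition isaacs_equation ::
  "real \<Rightarrow> (real^'n \<Rightarrow> real^'n \<Rightarrow> real^'n^'n \<Rightarrow> ereal)
    \<Rightarrow> real^'n \<Rightarrow> real \<Rightarrow> real^'n \<Rightarrow> real^'n^'n \<Rightarrow> ereal" where
  "isaacs_equation lam H x s p X = ereal (lam * s) - H x p X"

definition VI_upper_solution ::
  "real \<Rightarrow> (real^'n \<Rightarrow> real) \<Rightarrow> (real^'n \<Rightarrow> real) \<Rightarrow> (real^'n \<Rightarrow> real^'n \<Rightarrow> real^'n^'n \<Rightarrow> ereal)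
    \<Rightarrow> (real^'n \<Rightarrow> real) \<Rightarrow> bool" where
  "VI_upper_solution lam psi1 psi2 H =
     viscosity_solution (\<lambda>x s p X.
       max (min (ereal (lam * s) - H x p X) (ereal (lam * (s - psi2 x)))) (ereal (lam * (s - psi1 x))))"

definition VI_lower_solution ::
  "real \<Rightarrow> (real^'n \<Rightarrow> real) \<Rightarrow> (real^'n \<Rightarrow> real) \<Rightarrow> (real^'n \<Rightarrow> real^'n \<Rightarrow> real^'n^'n \<Rightarrow> ereal)
    \<Rightarrow> (real^'n \<Rightarrow> real) \<Rightarrow> bool" where
  "VI_lower_solution lam psi1 psi2 H =
     viscosity_solution (\<lambda>x s p X.
       min (max (ereal (lam * s) - H x p X) (ereal (lam * (s - psi1 x)))) (ereal (lam * (s - psi2 x))))"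

end

theory Submission
  imports Defs
begin

text \<open>The enlarged game only adds the option of stopping: once the square root of \<open>a\<close> is known to
  square to \<open>a\<close>, its Hamiltonians are \<open>min (\<lambda>\<psi>\<^sub>1) (max H\<^sup>+ (\<lambda>\<psi>\<^sub>2))\<close> and
  \<open>max (min H\<^sup>- (\<lambda>\<psi>\<^sub>1)) (\<lambda>\<psi>\<^sub>2)\<close>, so both equations coincide with the variational inequalities as
  functions of \<open>(x, s, p, X)\<close>, before any test function enters. The root exists by splitting off
  an eigenvector with positive eigenvalue and inducting on the dimension of the kernel. It is unique
  because, if \<open>S\<^sup>2 = T\<^sup>2\<close> and \<open>(S - T) x = \<mu> x\<close> with \<open>\<mu> \<noteq> 0\<close>, then
  \<open>0 = x \<bullet> (S\<^sup>2 - T\<^sup>2) x = \<mu> (x \<bullet> S x + x \<bullet> T x)\<close>, which forces \<open>x \<bullet> (S - T) x = 0\<close>.\<close>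

section \<open>Square roots of non-negative definite matrices\<close>

lemma symmetric_matrix_dot:
  fixes A :: "real^'n^'n"
  assumes "transpose A = A"
  shows "x \<bullet> (A *v y) = (A *v x) \<bullet> y"
  by (metis assms dot_lmul_matrix transpose_matrix_vector)

lemma nonneg_definite_dot:
  assumes "nonneg_definite A"
  shows "x \<bullet> (A *v y) = (A *v x) \<bullet> y"
  using assms symmetric_matrix_dot by (auto simp: nonneg_definite_def)

lemma symmetric_matrixI:
  fixes A :: "real^'n^'n"
  assumes "\<And>x y. x \<bullet> (A *v y) = (A *v x) \<bullet> y"
  shows "transpose A = A"
proof -
  have "transpose A *v x = A *v x" for x
  proof (rule vector_eq_rdot[THEN iffD1], rule allI)
    fix y
    have "(transpose A *v x) \<bullet> y = x \<bullet> (A *v y)"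
      by (metis dot_lmul_matrix transpose_matrix_vector)
    then show "(transpose A *v x) \<bullet> y = (A *v x) \<bullet> y"
      using assms by simp
  qed
  then show ?thesis
    by (simp add: matrix_eq)
qed

text \<open>If \<open>B *v x\<close> were nonzero, a small move from \<open>x\<close> against it
  would make the form negative: the first-order loss beats the second-order term.\<close>

lemma nonneg_definite_isotropic:
  fixes B :: "real^'n^'n"
  assumes B: "nonneg_definite B" and "x \<bullet> (B *v x) = 0"
  shows "B *v x = 0"
proof (rule ccontr)
  define w where "w = B *v x"
  define k where "k = w \<bullet> (B *v w)"
  \<comment> \<open>This step size gives \<open>t * k < w \<bullet> w\<close>; the
    \<open>+ 1\<close> keeps the denominator positive when \<open>k = 0\<close>.\<close>
  define t where "t = (w \<bullet> w) / (k + 1)"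
  assume "B *v x \<noteq> 0"
  then have w: "w \<bullet> w > 0"
    by (simp add: w_def)
  have k: "k \<ge> 0"
    using B by (simp add: k_def nonneg_definite_def)
  have t: "t > 0" "t * (k + 1) = w \<bullet> w"
    using w k by (auto simp: t_def)
  have "0 \<le> (x - t *\<^sub>R w) \<bullet> (B *v (x - t *\<^sub>R w))"
    using B by (simp add: nonneg_definite_def)
  also have "\<dots> = t * (t * k - 2 * (w \<bullet> w))"
    using assms(2) nonneg_definite_dot[OF B, of x w]
    by (simp add: matrix_vector_mult_diff_distrib matrix_vector_mult_scaleR inner_diff
        k_def algebra_simps flip: w_def)
  finally have "2 * (w \<bullet> w) \<le> t * k"
    using t(1) by (simp add: zero_le_mult_iff)
  with t w show False
    by (simp add: distrib_left)
qed

text \<open>The eigenvector is a maximiser of the quadratic form on the unit sphere, which exists by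
  compactness; \<open>m\<close> is the maximum.\<close>

lemma symmetric_matrix_pos_eigenvector:
  fixes A :: "real^'n^'n"
  assumes A: "transpose A = A" and y: "y \<bullet> (A *v y) > 0"
  obtains x m where "m > 0" "norm x = 1" "A *v x = m *\<^sub>R x"
proof -
  let ?q = "\<lambda>x. x \<bullet> (A *v x)"
  have "continuous_on (sphere 0 1) ?q"
    by (intro continuous_intros matrix_vector_mult_linear_continuous_on)
  moreover have "sphere (0::real^'n) 1 \<noteq> {}"
    by simp
  ultimately obtain x where x: "norm x = 1" and max: "\<And>z. norm z = 1 \<Longrightarrow> ?q z \<le> ?q x"
    using continuous_attains_sup[of "sphere 0 1" ?q] by auto
  define m where "m = ?q x"
  have bound: "?q z \<le> m * (z \<bullet> z)" for z
  proof (cases "z = 0")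
    case False
    then have "?q (z /\<^sub>R norm z) \<le> m"
      unfolding m_def by (intro max) simp
    moreover have "?q (z /\<^sub>R norm z) = ?q z / (norm z)\<^sup>2"
      by (simp add: matrix_vector_mult_scaleR power2_eq_square divide_inverse)
    ultimately show ?thesis
      using False by (simp add: pos_divide_le_eq power2_norm_eq_inner)
  qed simp
  have "0 < m * (y \<bullet> y)"
    using y bound[of y] by linarith
  then have "m > 0"
    by (metis inner_ge_zero not_less zero_less_mult_iff)
  \<comment> \<open>Maximality says that \<open>B\<close> is non-negative definite and isotropic at
    \<open>x\<close>, so \<open>B\<close> kills \<open>x\<close>: this is the eigenvalue
    equation.\<close>
  define B where "B = m *\<^sub>R mat 1 - A"
  have Bv: "B *v z = m *\<^sub>R z - A *v z" for z
    by (simp add: B_def matrix_vector_mult_diff_rdistrib flip: scaleR_matrix_vector_assoc)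
  have "nonneg_definite B"
    unfolding nonneg_definite_def
    using bound symmetric_matrix_dot[OF A]
    by (auto intro!: symmetric_matrixI simp: Bv inner_diff)
  moreover have "x \<bullet> (B *v x) = 0"
    using x by (simp add: Bv inner_diff m_def dot_square_norm)
  ultimately have "B *v x = 0"
    by (rule nonneg_definite_isotropic)
  then show thesis
    using that[OF \<open>m > 0\<close> x] by (simp add: Bv)
qed

lemma symmetric_matrix_eq_0I:
  fixes A :: "real^'n^'n"
  assumes A: "transpose A = A" and "\<And>x. x \<bullet> (A *v x) = 0"
  shows "A = 0"
proof -
  have "A *v x = 0" for x
    using assms by (intro nonneg_definite_isotropic) (auto simp: nonneg_definite_def)
  then show ?thesis
    by (simp add: matrix_eq)
qed

section \<open>Existence of the square root\<close>

text \<open>For a unit vector \<open>x\<close>, this is the orthogonal projection onto its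
  span.\<close>

definition outer_square :: "real^'n \<Rightarrow> real^'n^'n" where
  "outer_square x = (\<chi> i j. x $ i * x $ j)"

lemma outer_square_vector_mult: "outer_square x *v y = (x \<bullet> y) *\<^sub>R x"
  by (simp add: outer_square_def vec_eq_iff matrix_vector_mult_def inner_vec_def
      sum_distrib_right sum_distrib_left mult_ac)

lemma nonneg_sqrt_exists:
  fixes A :: "real^'n^'n"
  assumes "nonneg_definite A"
  shows "\<exists>S. nonneg_definite S \<and> S ** S = A"
  using assms
\<comment> \<open>The measure is the rank of \<open>A\<close>.\<close>
proof (induction "CARD('n) - dim {v. A *v v = 0}" arbitrary: A rule: less_induct)
  case less
  note A = \<open>nonneg_definite A\<close>
  show ?case
  proof (cases "A = 0")
    case True
    then show ?thesis
      using A by (intro exI[of _ 0]) auto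
  next
    case False
    then obtain y where "y \<bullet> (A *v y) \<noteq> 0"
      using symmetric_matrix_eq_0I A unfolding nonneg_definite_def by blast
    then have "y \<bullet> (A *v y) > 0"
      using A by (simp add: nonneg_definite_def order_less_le)
    then obtain x m where m: "m > 0" and x: "norm x = 1" and eig: "A *v x = m *\<^sub>R x"
      using symmetric_matrix_pos_eigenvector A unfolding nonneg_definite_def by blast
    have xx: "x \<bullet> x = 1"
      using x by (simp add: dot_square_norm)
    have xA: "x \<bullet> (A *v z) = m * (x \<bullet> z)" for z
      using nonneg_definite_dot[OF A, of x z] by (simp add: eig)
    define A' where "A' = A - m *\<^sub>R outer_square x"
    have A'v: "A' *v z = A *v z - (m * (x \<bullet> z)) *\<^sub>R x" for z
      by (simp add: A'_def matrix_vector_mult_diff_rdistrib outer_square_vector_mult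
          flip: scaleR_matrix_vector_assoc)
    have A'x: "A' *v x = 0"
      by (simp add: A'v eig xx)
    \<comment> \<open>The form of \<open>A'\<close> at \<open>z\<close> is that of \<open>A\<close>
      at the component of \<open>z\<close> orthogonal to \<open>x\<close>.\<close>
    have "0 \<le> z \<bullet> (A' *v z)" for z
    proof -
      let ?z = "z - (x \<bullet> z) *\<^sub>R x"
      have "0 \<le> ?z \<bullet> (A *v ?z)"
        using A by (simp add: nonneg_definite_def)
      also have "\<dots> = z \<bullet> (A' *v z)"
        by (simp add: A'v matrix_vector_mult_diff_distrib matrix_vector_mult_scaleR eig inner_diff
            xA xx inner_commute[of z x] algebra_simps)
      finally show ?thesis .
    qed
    moreover have "u \<bullet> (A' *v v) = (A' *v u) \<bullet> v" for u v
      by (simp add: A'v inner_diff nonneg_definite_dot[OF A, of u v] inner_commute[of u x])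
    ultimately have A': "nonneg_definite A'"
      by (simp add: nonneg_definite_def symmetric_matrixI)
    have "subspace {v. A *v v = 0}" "subspace {v. A' *v v = 0}"
      by (simp_all add: subspace_def matrix_vector_right_distrib matrix_vector_mult_scaleR)
    \<comment> \<open>The kernel of \<open>A\<close> is orthogonal to \<open>x\<close>, so
      \<open>A'\<close> agrees with \<open>A\<close> there; the new kernel vector is
      \<open>x\<close>.\<close>
    moreover have "{v. A *v v = 0} \<subset> {v. A' *v v = 0}"
    proof
      show "{v. A *v v = 0} \<subseteq> {v. A' *v v = 0}"
      proof safe
        fix v
        assume "A *v v = 0"
        with xA[of v] m show "A' *v v = 0"
          by (simp add: A'v)
      qed
      have "A *v x \<noteq> 0"
        using m x by (auto simp: eig)
      with A'x show "{v. A *v v = 0} \<noteq> {v. A' *v v = 0}"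
        by auto
    qed
    ultimately have "dim {v. A *v v = 0} < dim {v. A' *v v = 0}"
      by (metis dim_psubset span_eq_iff)
    moreover have "dim {v. A' *v v = 0} \<le> CARD('n)"
      using dim_subset_UNIV[of "{v. A' *v v = 0}"] by simp
    ultimately obtain S where S: "nonneg_definite S" "S ** S = A'"
      using less(1)[OF _ A'] by (meson diff_less_mono2 less_le_trans)
    have SS: "S *v (S *v z) = A' *v z" for z
      by (simp add: S matrix_vector_mul_assoc)
    have "(S *v x) \<bullet> (S *v x) = 0"
      using nonneg_definite_dot[OF S(1), of x "S *v x"] by (simp add: SS A'x)
    then have Sx: "S *v x = 0"
      by simp
    have xS: "x \<bullet> (S *v z) = 0" for z
      using nonneg_definite_dot[OF S(1), of x z] by (simp add: Sx)
    \<comment> \<open>Since \<open>S\<close> kills \<open>x\<close> and maps into its orthogonal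
      complement, the cross terms of \<open>R ** R\<close> vanish, leaving
      \<open>A' + m *\<^sub>R outer_square x = A\<close>.\<close>
    define R where "R = S + sqrt m *\<^sub>R outer_square x"
    have Rv: "R *v z = S *v z + (sqrt m * (x \<bullet> z)) *\<^sub>R x" for z
      by (simp add: R_def matrix_vector_mult_add_rdistrib outer_square_vector_mult
          flip: scaleR_matrix_vector_assoc)
    have "0 \<le> z \<bullet> (R *v z)" for z
      using S(1) m
      by (simp add: Rv inner_add nonneg_definite_def inner_commute[of z x] mult.assoc)
    moreover have "u \<bullet> (R *v v) = (R *v u) \<bullet> v" for u v
      by (simp add: Rv inner_add nonneg_definite_dot[OF S(1), of u v] inner_commute[of u x])
    ultimately have "nonneg_definite R"
      by (simp add: nonneg_definite_def symmetric_matrixI)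
    moreover have "R ** R = A"
      unfolding matrix_eq using m
      by (simp add: Rv A'v SS Sx xS xx matrix_vector_right_distrib matrix_vector_mult_scaleR
          inner_add flip: matrix_vector_mul_assoc)
    ultimately show ?thesis
      by blast
  qed
qed

section \<open>Uniqueness of the square root\<close>

lemma square_eq_diff_nonpos:
  fixes S T :: "real^'n^'n"
  assumes S: "nonneg_definite S" and T: "nonneg_definite T" and eq: "S ** S = T ** T"
  shows "y \<bullet> ((S - T) *v y) \<le> 0"
proof (rule ccontr)
  assume "\<not> y \<bullet> ((S - T) *v y) \<le> 0"
  then have "y \<bullet> ((S - T) *v y) > 0"
    by simp
  moreover have "transpose (S - T) = S - T"
    by (rule symmetric_matrixI)
      (simp add: matrix_vector_mult_diff_rdistrib inner_diff
        nonneg_definite_dot[OF S] nonneg_definite_dot[OF T])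
  ultimately obtain x m where m: "m > 0" and x: "norm x = 1" and eig: "(S - T) *v x = m *\<^sub>R x"
    using symmetric_matrix_pos_eigenvector by blast
  from eig have Sx: "S *v x = T *v x + m *\<^sub>R x"
    by (simp add: matrix_vector_mult_diff_rdistrib algebra_simps)
  have "(S *v x) \<bullet> (S *v x) = (T *v x) \<bullet> (T *v x)"
    using nonneg_definite_dot[OF S, of x "S *v x"] nonneg_definite_dot[OF T, of x "T *v x"]
    by (simp add: matrix_vector_mul_assoc eq)
  moreover have "x \<bullet> x = 1"
    using x by (simp add: dot_square_norm)
  \<comment> \<open>Expanding the square of \<open>T *v x + m *\<^sub>R x\<close> leaves this excess
    over the square of \<open>T *v x\<close>.\<close>
  ultimately have "m * (2 * (x \<bullet> (T *v x)) + m) = 0"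
    unfolding Sx inner_add inner_scaleR_left inner_scaleR_right inner_commute[of "T *v x" x]
    by (simp add: distrib_left)
  moreover have "0 \<le> x \<bullet> (T *v x)"
    using T by (simp add: nonneg_definite_def)
  ultimately show False
    using m by auto
qed

lemma nonneg_sqrt_unique:
  fixes S T :: "real^'n^'n"
  assumes S: "nonneg_definite S" and T: "nonneg_definite T" and eq: "S ** S = T ** T"
  shows "S = T"
proof -
  have "S - T = 0"
  proof (rule symmetric_matrix_eq_0I)
    show "transpose (S - T) = S - T"
      by (rule symmetric_matrixI)
        (simp add: matrix_vector_mult_diff_rdistrib inner_diff
          nonneg_definite_dot[OF S] nonneg_definite_dot[OF T])
    show "x \<bullet> ((S - T) *v x) = 0" for x
      using square_eq_diff_nonpos[OF S T eq, of x]
        square_eq_diff_nonpos[OF T S eq[symmetric], of x]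
      by (simp add: matrix_vector_mult_diff_rdistrib inner_diff)
  qed
  then show ?thesis
    by simp
qed

lemma nonneg_sqrt:
  assumes "nonneg_definite A"
  shows "nonneg_definite (nonneg_sqrt A)" "nonneg_sqrt A ** nonneg_sqrt A = A"
proof -
  have "\<exists>!S. nonneg_definite S \<and> S ** S = A"
    using nonneg_sqrt_exists[OF assms] nonneg_sqrt_unique by blast
  from theI'[OF this] show "nonneg_definite (nonneg_sqrt A)" "nonneg_sqrt A ** nonneg_sqrt A = A"
    by (simp_all add: nonneg_sqrt_def)
qed

section \<open>Hamiltonians of the extended game\<close>

text \<open>The root is symmetric, so multiplying it by its transpose squares it.\<close>

lemma a_hat_Some:
  assumes "nonneg_definite (a x u1 u2)"
  shows "a_hat a x (Some u1) (Some u2) = a x u1 u2"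
  using nonneg_sqrt[OF assms]
  by (simp add: a_hat_def sigma_bar_def extend_zero_def nonneg_definite_def)

lemma isaacs_integrand_bar_Some:
  assumes "nonneg_definite (a x u1 u2)"
  shows "isaacs_integrand (a_hat a) (extend_zero b) (r_bar lam psi1 psi2 r) x p X (Some u1) (Some u2)
    = isaacs_integrand a b r x p X u1 u2"
  by (simp add: isaacs_integrand_def a_hat_Some[of a, OF assms] extend_zero_def r_bar_def)

lemma isaacs_integrand_bar_None1:
  "isaacs_integrand (a_hat a) (extend_zero b) (r_bar lam psi1 psi2 r) x p X None (Some u2)
    = lam * psi1 x"
  by (simp add: isaacs_integrand_def a_hat_def sigma_bar_def extend_zero_def r_bar_def trace_def)

lemma isaacs_integrand_bar_None2:
  "isaacs_integrand (a_hat a) (extend_zero b) (r_bar lam psi1 psi2 r) x p X w1 None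
    = lam * psi2 x"
  by (simp add: isaacs_integrand_def a_hat_def sigma_bar_def extend_zero_def r_bar_def trace_def
      split: option.split)

text \<open>The row \<open>None\<close> yields the larger obstacle \<open>psi1\<close>, since a
  nonempty \<open>U2\<close> lets the second player decline to stop. Each other row gains the option
  \<open>psi2\<close>, and \<open>sup\<close> with a constant commutes with
  \<open>INF\<close>.\<close>

lemma isaacs_upper_bar_eq:
  assumes a: "\<forall>u1\<in>U1. \<forall>u2\<in>U2. nonneg_definite (a x u1 u2)"
    and "U2 \<noteq> {}" and "lam * psi2 x \<le> lam * psi1 x"
  shows "isaacs_upper_bar lam psi1 psi2 U1 U2 a b r x p X
    = min (ereal (lam * psi1 x)) (max (isaacs_upper U1 U2 a b r x p X) (ereal (lam * psi2 x)))"
proof -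
  let ?f = "\<lambda>u1 u2. ereal (isaacs_integrand a b r x p X u1 u2)"
  have "isaacs_upper_bar lam psi1 psi2 U1 U2 a b r x p X
    = inf (sup (ereal (lam * psi2 x)) (ereal (lam * psi1 x)))
        (INF u1\<in>U1. sup (ereal (lam * psi2 x)) (SUP u2\<in>U2. ?f u1 u2))"
    using a \<open>U2 \<noteq> {}\<close>
    by (simp add: isaacs_upper_bar_def isaacs_upper_def adjoin_symbol_def image_image
        isaacs_integrand_bar_None1 isaacs_integrand_bar_None2,
      simp add: isaacs_integrand_bar_Some cong: INF_cong SUP_cong)
  also have "\<dots> = inf (ereal (lam * psi1 x))
      (sup (ereal (lam * psi2 x)) (INF u1\<in>U1. SUP u2\<in>U2. ?f u1 u2))"
    using assms(3) unfolding sup_INF[symmetric] by (simp add: sup_absorb2)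
  finally show ?thesis
    by (simp add: isaacs_upper_def inf_min sup_max max.commute)
qed

text \<open>The column \<open>None\<close> is constantly \<open>lam * psi2 x\<close>; in each other
  column the first player gains the option \<open>psi1\<close>, and \<open>inf\<close> with a
  constant commutes with \<open>SUP\<close>.\<close>

lemma isaacs_lower_bar_eq:
  assumes a: "\<forall>u1\<in>U1. \<forall>u2\<in>U2. nonneg_definite (a x u1 u2)"
  shows "isaacs_lower_bar lam psi1 psi2 U1 U2 a b r x p X
    = max (min (isaacs_lower U1 U2 a b r x p X) (ereal (lam * psi1 x))) (ereal (lam * psi2 x))"
proof -
  let ?f = "\<lambda>u1 u2. ereal (isaacs_integrand a b r x p X u1 u2)"
  have "isaacs_lower_bar lam psi1 psi2 U1 U2 a b r x p X
    = sup (ereal (lam * psi2 x)) (SUP u2\<in>U2. inf (ereal (lam * psi1 x)) (INF u1\<in>U1. ?f u1 u2))"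
    using a
    \<comment> \<open>An infimum of a constant over an empty \<open>U1\<close> is top, yet the entry
      at \<open>None\<close> keeps the value of the column.\<close>
    by (cases "U1 = {}"; simp add: isaacs_lower_bar_def isaacs_lower_def adjoin_symbol_def image_image
        isaacs_integrand_bar_None1 isaacs_integrand_bar_None2;
      simp add: isaacs_integrand_bar_Some cong: INF_cong SUP_cong)
  also have "\<dots> = sup (ereal (lam * psi2 x))
      (inf (ereal (lam * psi1 x)) (SUP u2\<in>U2. INF u1\<in>U1. ?f u1 u2))"
    unfolding inf_SUP[symmetric] by simp
  finally show ?thesis
    by (simp add: isaacs_lower_def inf_min sup_max max.commute min.commute)
qed

text \<open>Subtraction from \<open>c\<close> reverses the order even at infinite arguments, because
  \<open>c\<close> is finite.\<close>

lemma ereal_minus_max: "ereal c - max u v = min (ereal c - u) (ereal c - v)"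
  by (cases u; cases v) (auto simp: max_def min_def)

lemma ereal_minus_min: "ereal c - min u v = max (ereal c - u) (ereal c - v)"
  by (cases u; cases v) (auto simp: max_def min_def)

theorem theorem2p4:
  fixes lam :: real
    and U1 :: "'u::metric_space set"
    and U2 :: "'w::metric_space set"
    and b :: "real^'n \<Rightarrow> 'u \<Rightarrow> 'w \<Rightarrow> real^'n"
    and a :: "real^'n \<Rightarrow> 'u \<Rightarrow> 'w \<Rightarrow> real^'n^'n"
    and r :: "real^'n \<Rightarrow> 'u \<Rightarrow> 'w \<Rightarrow> real"
    and psi1 psi2 :: "real^'n \<Rightarrow> real"
  assumes "lam > 0"
    and "compact U1" and "compact U2"
    and "\<forall>x. \<forall>u1\<in>U1. \<forall>u2\<in>U2. nonneg_definite (a x u1 u2)"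
    and upper_real_valued: "\<forall>x p X. \<bar>isaacs_upper U1 U2 a b r x p X\<bar> \<noteq> \<infinity>"
    and lower_real_valued: "\<forall>x p X. \<bar>isaacs_lower U1 U2 a b r x p X\<bar> \<noteq> \<infinity>"
    and "\<forall>x. psi2 x \<le> psi1 x"
  shows "(\<forall>v. continuous_on UNIV v \<longrightarrow>
            (viscosity_solution (isaacs_equation lam (isaacs_upper_bar lam psi1 psi2 U1 U2 a b r)) v
             \<longleftrightarrow> VI_upper_solution lam psi1 psi2 (isaacs_upper U1 U2 a b r) v))
       \<and> (\<forall>v. continuous_on UNIV v \<longrightarrow>
            (viscosity_solution (isaacs_equation lam (isaacs_lower_bar lam psi1 psi2 U1 U2 a b r)) v
             \<longleftrightarrow> VI_lower_solution lam psi1 psi2 (isaacs_lower U1 U2 a b r) v))"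
proof -
  \<comment> \<open>A supremum over an empty \<open>U2\<close> would be minus infinity, so real
    values of the lower Hamiltonian exclude it.\<close>
  have ne: "U2 \<noteq> {}"
  proof
    assume "U2 = {}"
    then have "isaacs_lower U1 U2 a b r 0 0 0 = - \<infinity>"
      by (simp add: isaacs_lower_def bot_ereal_def)
    then show False
      using lower_real_valued[rule_format, of 0 0 0] by simp
  qed
  \<comment> \<open>Subtracting the truncated Hamiltonian from \<open>lam * s\<close> swaps
    \<open>min\<close> and \<open>max\<close>, which produces the obstacle form.\<close>
  have "isaacs_equation lam (isaacs_upper_bar lam psi1 psi2 U1 U2 a b r)
    = (\<lambda>x s p X. max (min (ereal (lam * s) - isaacs_upper U1 U2 a b r x p X)
        (ereal (lam * (s - psi2 x)))) (ereal (lam * (s - psi1 x))))"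
  proof (intro ext)
    fix x s p X
    have "lam * psi2 x \<le> lam * psi1 x"
      using assms(1,7) by simp
    then show "isaacs_equation lam (isaacs_upper_bar lam psi1 psi2 U1 U2 a b r) x s p X
      = max (min (ereal (lam * s) - isaacs_upper U1 U2 a b r x p X)
        (ereal (lam * (s - psi2 x)))) (ereal (lam * (s - psi1 x)))"
      using assms(4) ne
      by (simp add: isaacs_equation_def isaacs_upper_bar_eq ereal_minus_max ereal_minus_min
          right_diff_distrib max.commute min.commute)
  qed
  moreover have "isaacs_equation lam (isaacs_lower_bar lam psi1 psi2 U1 U2 a b r)
    = (\<lambda>x s p X. min (max (ereal (lam * s) - isaacs_lower U1 U2 a b r x p X)
        (ereal (lam * (s - psi1 x)))) (ereal (lam * (s - psi2 x))))"
    using assms(4)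
    by (intro ext) (simp add: isaacs_equation_def isaacs_lower_bar_eq ereal_minus_max
        ereal_minus_min right_diff_distrib)
  ultimately show ?thesis
    by (simp add: VI_upper_solution_def VI_lower_solution_def)
qed

end
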